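(* There are positive real numbers $\alpha,\widetilde\alpha$ and $r<1$ such that, as $n\to\infty$, $$H_n=\alpha\phi^{n-1}+O(\phi^{nr}),\qquad \widetilde H_n=\widetilde\alpha\widetilde\phi^{\,n-1}+O(\widetilde\phi^{\,nr}),\qquad \lim_{n\to\infty}\frac{H_n}{\widetilde H_n^{\gamma}}=\frac{\alpha}{\widetilde\alpha^{\gamma}}>0,$$ where $\gamma=\log_{\widetilde\phi}\phi$; moreover $1<\phi<\widetilde\phi$.
   Context: A coefficient function is a sequence $\mu=(\mu_1,\mu_2,\dots)$ of non-negative integers. For a sequence $G$, $\sum\mu G:=\sum_{k\ge1}\mu_kG_k$. For $n\ge1$, $\mathrm{rev}_n(\mu)=(\mu_n,\mu_{n-1},\dots,\mu_1,0,0,\dots)$. For a list $L=(e_1,\dots,e_N)$ of non-negative integers with $N\ge2$, $e_1\ne0$, let $\beta^*$ be the coefficient function with $\beta^*_k=e_j$ whenever $k\equiv j\pmod N$, $1\le j\le N$; for $n\ge2$ let $\theta^n=\mathrm{rev}_{n-1}(\beta^* )$ (the maximal $L$-block at index $n-1$, support interval $[1,n-1]$). A proper $L$-block at index $n-1$ ($n\ge2$) is a coefficient function $\zeta$ such that for some $k\in[1,n-1]$: $\zeta_j=\theta^n_j$ for $j>k$, $\zeta_k<\theta^n_k$, $\zeta_j=0$ for $j<k$; its support interval is $[k,n-1]$. The periodic Zeckendorf collection for positive integers determined by $L$ is the set of all finite sums (including $0$) of $L$-blocks with pairwise disjoint support intervals. Its fundamental sequence $H$ is given by $H_1=1$, $H_n=1+\sum\theta^nH$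 ($n\ge2$). The characteristic polynomial $x^N-\sum_{k=1}^{N-1}e_kx^{N-k}-(1+e_N)$ has a unique positive real zero. Let $\mathcal E\subsetneq\widetilde{\mathcal E}$ be the periodic Zeckendorf collections for positive integers determined by two such lists $L$ and $\widetilde L$, with fundamental sequences $H,\widetilde H$, and let $\phi,\widetilde\phi$ be the unique positive zeros of the characteristic polynomials of $L$ and $\widetilde L$. *)

theory Defs
  imports Complex_Main "HOL-Library.Landau_Symbols" "HOL-Computational_Algebra.Polynomial"
begin

text \<open>
  A coefficient function \<open>(\<mu>\<^sub>1, \<mu>\<^sub>2, \<dots>)\<close> is represented by a function on \<^typ>\<open>nat\<close>.
  Index \<open>0\<close> is not part of the sequence; every coefficient function built below is \<open>0\<close> there.
\<close>

type_synonym coeff_fun = "nat \<Rightarrow> nat"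

text \<open>Only meaningful when \<open>\<mu>\<close> has finite support.\<close>

definition coeff_sum :: "coeff_fun \<Rightarrow> (nat \<Rightarrow> nat) \<Rightarrow> nat" where
  "coeff_sum \<mu> G = (\<Sum>k | 1 \<le> k \<and> \<mu> k \<noteq> 0. \<mu> k * G k)"

definition rev_coeff :: "nat \<Rightarrow> coeff_fun \<Rightarrow> coeff_fun" where
  "rev_coeff n \<mu> = (\<lambda>k. if 1 \<le> k \<and> k \<le> n then \<mu> (n + 1 - k) else 0)"

text \<open>The entry \<open>e\<^sub>j\<close> (\<open>1 \<le> j \<le> N\<close>) of \<open>L = (e\<^sub>1, \<dots>, e\<^sub>N)\<close> is \<open>L ! (j - 1)\<close>.\<close>

definition admissible_list :: "nat list \<Rightarrow> bool" where
  "admissible_list L \<longleftrightarrow> length L \<ge> 2 \<and> L ! 0 \<noteq> 0"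

definition beta_star :: "nat list \<Rightarrow> coeff_fun" where
  "beta_star L = (\<lambda>k. if k = 0 then 0 else L ! ((k - 1) mod length L))"

definition theta :: "nat list \<Rightarrow> nat \<Rightarrow> coeff_fun" where
  "theta L n = rev_coeff (n - 1) (beta_star L)"

text \<open>
  Blocks are paired with their support intervals: the zero function is a proper block at every
  index, so the support interval is not determined by the coefficient function alone.
\<close>

definition maximal_blocks :: "nat list \<Rightarrow> (coeff_fun \<times> nat set) set" where
  "maximal_blocks L = {(theta L n, {1..n - 1}) | n. n \<ge> 2}"

definition proper_blocks :: "nat list \<Rightarrow> (coeff_fun \<times> nat set) set" where
  "proper_blocks L = {(\<zeta>, {k..n - 1}) | \<zeta> k n. n \<ge> 2 \<and> k \<in> {1..n - 1} \<and>
     (\<forall>j>k. \<zeta> j = theta L n j) \<and> \<zeta> k < theta L n k \<and> (\<forall>j<k. \<zeta> j = 0)}"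

definition L_blocks :: "nat list \<Rightarrow> (coeff_fun \<times> nat set) set" where
  "L_blocks L = maximal_blocks L \<union> proper_blocks L"

text \<open>
  Support intervals are nonempty, so a finite family of blocks with pairwise disjoint support
  intervals has no repetitions and can be given as a finite set.
\<close>

definition zeckendorf_collection :: "nat list \<Rightarrow> coeff_fun set" where
  "zeckendorf_collection L =
     {(\<lambda>j. \<Sum>b\<in>B. fst b j) | B. finite B \<and> B \<subseteq> L_blocks L \<and>
        pairwise (\<lambda>b c. disjnt (snd b) (snd c)) B}"

text \<open>The value at \<open>0\<close> is a dummy.\<close>

fun fundamental_seq :: "nat list \<Rightarrow> nat \<Rightarrow> nat" where
  "fundamental_seq L n =
     (if n \<le> 1 then 1 else 1 + (\<Sum>k=1..n - 1. theta L n k * fundamental_seq L k))"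

declare fundamental_seq.simps [simp del]

lemma fundamental_seq_1: "fundamental_seq L 1 = 1"
  by (simp add: fundamental_seq.simps)

lemma fundamental_seq_rec:
  assumes "n \<ge> 2"
  shows "fundamental_seq L n = 1 + coeff_sum (theta L n) (fundamental_seq L)"
proof -
  have "coeff_sum (theta L n) (fundamental_seq L) =
      (\<Sum>k=1..n - 1. theta L n k * fundamental_seq L k)"
    unfolding coeff_sum_def
    by (rule sum.mono_neutral_left) (auto simp: theta_def rev_coeff_def split: if_splits)
  with assms show ?thesis
    by (subst fundamental_seq.simps) simp
qed

definition zeckendorf_poly :: "nat list \<Rightarrow> real poly" where
  "zeckendorf_poly L = (let N = length L in
     monom 1 N - (\<Sum>k=1..N - 1. monom (real (L ! (k - 1))) (N - k)) - [:1 + real (L ! (N - 1)):])"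

definition positive_zero :: "nat list \<Rightarrow> real" where
  "positive_zero L = (THE x. x > 0 \<and> poly (zeckendorf_poly L) x = 0)"

end

theory Submission imports Defs begin

text \<open>
  Asymptotics: for \<open>n > N\<close> the sequence satisfies \<open>H\<^sub>n = (\<Sum>k=1..N. c\<^sub>k * H\<^sub>n\<^sub>-\<^sub>k)\<close>, where \<open>c\<^sub>k\<close> are the
  coefficients of the characteristic polynomial. After division by powers of \<open>\<phi>\<close> every term is a
  fixed convex combination of its \<open>N\<close> predecessors, in which the weight of the immediate
  predecessor is positive. Hence the oscillation over a window of length \<open>N\<close> shrinks by a constant
  factor from each window to the next, which gives exponential convergence to a positive limit.

  Comparison of the zeros: \<open>\<phi>\<close> is the base in which the periodic digit sequence \<open>\<beta>\<^sup>*\<close> has value \<open>1\<close>,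
  that is \<open>(\<Sum>i. \<beta>\<^sup>*\<^sub>i * \<phi> ^ (-i)) = 1\<close>. In base \<open>\<phi>'\<close> the values of disjoint blocks of \<open>L'\<close> telescope, so a
  member of the larger collection supported on \<open>[1, k - 1]\<close> has value at most \<open>\<phi>' ^ k\<close>. Since the
  collections differ, \<open>\<beta>\<^sup>*\<close> and the corresponding sequence of \<open>L'\<close> differ first at some index \<open>m\<close>; the
  maximal block of \<open>L\<close> at each index \<open>n - 1 \<ge> m\<close> then starts with a proper block of \<open>L'\<close> of length \<open>m\<close>.
  This keeps all partial values of \<open>\<beta>\<^sup>*\<close> in base \<open>\<phi>'\<close> below a constant less than \<open>1\<close>, so \<open>\<phi> < \<phi>'\<close>.
\<close>

section \<open>Averaging recurrences\<close>

text \<open>\<open>p 1 > 0\<close> makes the oscillation contract; \<open>p 1 < 1\<close> keeps the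
  factor \<open>1 - p 1 ^ N\<close> positive, so that its root is a valid rate.\<close>

locale averaging_recurrence =
  fixes p :: "nat \<Rightarrow> real" and N :: nat
  assumes N_pos: "N \<ge> 1"
    and p_nonneg: "\<And>k. p k \<ge> 0"
    and p_sum: "(\<Sum>k=1..N. p k) = 1"
    and p_1: "0 < p 1" "p 1 < 1"
begin

definition solution :: "(nat \<Rightarrow> real) \<Rightarrow> bool" where
  "solution u \<longleftrightarrow> (\<forall>n\<ge>N. u n = (\<Sum>k=1..N. p k * u (n - k)))"

text \<open>Turns each lower bound below into an upper bound.\<close>

lemma solution_uminus: "solution u \<Longrightarrow> solution (\<lambda>n. - u n)"
  by (simp add: solution_def sum_negf)

text \<open>The weights sum to 1, so subtracting \<open>a\<close> from all values leaves nonnegative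
  summands; only the one with \<open>k = 1\<close> is kept.\<close>

lemma solution_step:
  assumes u: "solution u" and n: "n \<ge> N" and a: "\<And>i. n - N \<le> i \<Longrightarrow> i < n \<Longrightarrow> a \<le> u i"
  shows "a + p 1 * (u (n - 1) - a) \<le> u n"
proof -
  have "u n - a = (\<Sum>k=1..N. p k * u (n - k)) - (\<Sum>k=1..N. p k) * a"
    using u n unfolding p_sum by (simp add: solution_def)
  also have "\<dots> = (\<Sum>k=1..N. p k * (u (n - k) - a))"
    by (simp add: sum_distrib_left sum_subtractf algebra_simps)
  also have "\<dots> \<ge> p 1 * (u (n - 1) - a)"
    using N_pos p_nonneg n a
    by (intro member_le_sum[where f = "\<lambda>k. p k * (u (n - k) - a)"]) (auto intro!: mult_nonneg_nonneg)
  finally show ?thesis by linarith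
qed

lemma solution_lower_bound:
  assumes u: "solution u" and a: "\<And>i. s \<le> i \<Longrightarrow> i < s + N \<Longrightarrow> a \<le> u i" and "s \<le> i"
  shows "a \<le> u i"
  using \<open>s \<le> i\<close>
proof (induction i rule: less_induct)
  case (less i)
  show ?case
  proof (cases "i < s + N")
    case False
    have IH: "a \<le> u j" if "i - N \<le> j" "j < i" for j
      using that False less by auto
    have "a \<le> u (i - 1)"
      using IH N_pos False by auto
    then have "a \<le> a + p 1 * (u (i - 1) - a)"
      using p_1 by simp
    also have "\<dots> \<le> u i"
      using False IH by (intro solution_step[OF u]) auto
    finally show ?thesis .
  qed (use a less in auto)
qed

text \<open>The excess of the last value of a window over \<open>a\<close> passes to each next term
  with factor at least \<open>p 1\<close>. After \<open>N\<close> steps a whole window lies above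
  the new bound, and \<open>solution_lower_bound\<close> extends this to all later indices.\<close>

lemma solution_lower_bound_improved:
  assumes u: "solution u" and a: "\<And>i. s \<le> i \<Longrightarrow> a \<le> u i" and "s + N \<le> i"
  shows "a + p 1 ^ N * (u (s + N - 1) - a) \<le> u i"
proof -
  let ?x = "u (s + N - 1)"
  have x: "a \<le> ?x" using a N_pos by simp
  have powers: "a + p 1 ^ j * (?x - a) \<le> u (s + N - 1 + j)" for j
  proof (induction j)
    case (Suc j)
    have "a + p 1 ^ Suc j * (?x - a) \<le> a + p 1 * (u (s + N - 1 + j) - a)"
      using Suc p_1 mult_left_mono[of "p 1 ^ j * (?x - a)" "u (s + N - 1 + j) - a" "p 1"]
      by simp
    also have "\<dots> \<le> u (s + N - 1 + Suc j)"
      using solution_step[OF u, of "s + N - 1 + Suc j" a] a N_pos by simp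
    finally show ?case .
  qed simp
  show ?thesis
  proof (rule solution_lower_bound[OF u _ \<open>s + N \<le> i\<close>])
    fix i assume i: "s + N \<le> i" "i < s + N + N"
    define j where "j = i - (s + N - 1)"
    have j: "i = s + N - 1 + j" "j \<le> N"
      using i N_pos by (auto simp: j_def)
    have "p 1 ^ N * (?x - a) \<le> p 1 ^ j * (?x - a)"
      using x p_1 j by (intro mult_right_mono power_decreasing) auto
    with powers[of j] j show "a + p 1 ^ N * (?x - a) \<le> u i" by simp
  qed
qed

text \<open>Both bounds are improved with the same pivot, the last value of the window. The gains
  \<open>?x - a'\<close> and \<open>b' - ?x\<close> add up to \<open>b' - a'\<close> wherever the
  pivot lies.\<close>

lemma solution_contraction:
  assumes u: "solution u" and ab: "\<And>i. i < N \<Longrightarrow> a \<le> u i \<and> u i \<le> b"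
  shows "\<exists>a' b'. b' - a' = (1 - p 1 ^ N) ^ j * (b - a) \<and>
           (\<forall>i\<ge>j * N. a' \<le> u i \<and> u i \<le> b')"
proof (induction j)
  case 0
  have "a \<le> u i" for i
    by (rule solution_lower_bound[OF u, of 0]) (use ab in auto)
  moreover have "- b \<le> - u i" for i
    by (rule solution_lower_bound[OF solution_uminus[OF u], of 0]) (use ab in auto)
  ultimately show ?case by auto
next
  case (Suc j)
  then obtain a' b' where IH: "b' - a' = (1 - p 1 ^ N) ^ j * (b - a)"
    "\<And>i. i \<ge> j * N \<Longrightarrow> a' \<le> u i" "\<And>i. i \<ge> j * N \<Longrightarrow> u i \<le> b'"
    by blast
  let ?x = "u (j * N + N - 1)"
  let ?a = "a' + p 1 ^ N * (?x - a')" and ?b = "b' - p 1 ^ N * (b' - ?x)"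
  have "?a \<le> u i" if "j * N + N \<le> i" for i
    by (rule solution_lower_bound_improved[OF u IH(2) that])
  moreover have "u i \<le> ?b" if "j * N + N \<le> i" for i
  proof -
    have "- b' + p 1 ^ N * (- ?x - - b') \<le> - u i"
      by (rule solution_lower_bound_improved[OF solution_uminus[OF u] _ that]) (use IH in auto)
    then show ?thesis by (simp add: algebra_simps)
  qed
  moreover have "?b - ?a = (1 - p 1 ^ N) * (b' - a')"
    by (simp add: algebra_simps)
  ultimately show ?case
    using IH(1) by (intro exI[of _ ?a] exI[of _ ?b]) (auto simp: add.commute)
qed

theorem solution_exponential_convergence:
  assumes u: "solution u" and ab: "\<And>i. i < N \<Longrightarrow> a \<le> u i \<and> u i \<le> b"
  obtains l \<rho> C where "a \<le> l" "0 < \<rho>" "\<rho> < 1" "\<And>n. \<bar>u n - l\<bar> \<le> C * \<rho> ^ n"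
proof -
  define \<sigma> where "\<sigma> = 1 - p 1 ^ N"
  \<comment> \<open>Converts the factor \<open>\<sigma>\<close> per window into a factor per
    index.\<close>
  define \<rho> where "\<rho> = root N \<sigma>"
  have \<sigma>: "0 < \<sigma>" "\<sigma> < 1"
    using p_1 N_pos power_Suc_less_one[of "p 1" "N - 1"] by (auto simp: \<sigma>_def)
  have \<rho>: "0 < \<rho>" "\<rho> < 1" "\<rho> ^ N = \<sigma>"
    using \<sigma> N_pos by (auto simp: \<rho>_def)
  have "a \<le> b"
    using ab[of 0] N_pos by auto
  have osc: "\<bar>u m - u n\<bar> \<le> \<sigma> ^ j * (b - a)" if mn: "j * N \<le> m" "j * N \<le> n" for j m n
  proof -
    obtain a' b' where "b' - a' = \<sigma> ^ j * (b - a)" "\<And>i. i \<ge> j * N \<Longrightarrow> a' \<le> u i \<and> u i \<le> b'"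
      using solution_contraction[OF u ab, of j] unfolding \<sigma>_def by blast
    from this(1) this(2)[OF mn(1)] this(2)[OF mn(2)] show ?thesis by linarith
  qed
  have "Cauchy u"
  proof (rule CauchyI)
    fix e :: real assume "e > 0"
    have "(\<lambda>j. \<sigma> ^ j * (b - a)) \<longlonglongrightarrow> 0 * (b - a)"
      using \<sigma> by (intro tendsto_intros LIMSEQ_power_zero) auto
    then have "eventually (\<lambda>j. \<sigma> ^ j * (b - a) < e) sequentially"
      using \<open>e > 0\<close> by (intro order_tendstoD(2)) auto
    then obtain j where "\<sigma> ^ j * (b - a) < e"
      by (auto simp: eventually_sequentially)
    then show "\<exists>M. \<forall>m\<ge>M. \<forall>n\<ge>M. norm (u m - u n) < e"
      using osc by (intro exI[of _ "j * N"]) (auto intro: le_less_trans)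
  qed
  then obtain l where l: "u \<longlonglongrightarrow> l"
    using Cauchy_convergent convergent_def by blast
  have "a \<le> l"
  proof (rule LIMSEQ_le_const[OF l])
    show "\<exists>M. \<forall>n\<ge>M. a \<le> u n"
      using solution_lower_bound[OF u, of 0 a] ab by auto
  qed
  moreover have "\<bar>u n - l\<bar> \<le> (b - a) / \<sigma> * \<rho> ^ n" for n
  proof -
    let ?j = "n div N"
    have "\<bar>u n - l\<bar> \<le> \<sigma> ^ ?j * (b - a)"
    proof (rule LIMSEQ_le_const2)
      show "(\<lambda>m. \<bar>u n - u m\<bar>) \<longlonglongrightarrow> \<bar>u n - l\<bar>"
        by (intro tendsto_intros l)
      show "\<exists>M. \<forall>m\<ge>M. \<bar>u n - u m\<bar> \<le> \<sigma> ^ ?j * (b - a)"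
        using osc[of ?j n] by auto
    qed
    also have "\<sigma> ^ ?j * (b - a) \<le> \<rho> ^ n / \<sigma> * (b - a)"
    proof (intro mult_right_mono)
      \<comment> \<open>Since \<open>n < N * ?j + N\<close>, one further factor
        \<open>\<sigma>\<close> pays for the incomplete window.\<close>
      have "\<sigma> ^ ?j * \<sigma> = \<rho> ^ (N * ?j + N)"
        by (simp add: power_add power_mult \<rho>)
      also have "\<dots> \<le> \<rho> ^ n"
        using \<rho> N_pos mult_div_mod_eq[of N n] mod_less_divisor[of N n]
        by (intro power_decreasing) linarith+
      finally show "\<sigma> ^ ?j \<le> \<rho> ^ n / \<sigma>"
        using \<sigma> by (simp add: field_simps)
    qed (use \<open>a \<le> b\<close> in auto)
    finally show ?thesis by (simp add: mult.commute)
  qed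
  ultimately show thesis
    using \<rho> that by blast
qed

end

section \<open>The positive zero of the characteristic polynomial\<close>

text \<open>For \<open>1 \<le> k \<le> N\<close> this is minus the coefficient of
  \<open>x ^ (N - k)\<close> in the characteristic polynomial; the extra unit comes from the
  constant term \<open>1 + e_N\<close>.\<close>

definition char_coeff :: "nat list \<Rightarrow> nat \<Rightarrow> nat" where
  "char_coeff L k = beta_star L k + (if k = length L then 1 else 0)"

lemma beta_star_1: "admissible_list L \<Longrightarrow> beta_star L 1 > 0"
  by (simp add: beta_star_def admissible_list_def)

lemma beta_star_periodic: "k \<ge> 1 \<Longrightarrow> beta_star L (k + q * length L) = beta_star L k"
  by (cases k) (simp_all add: beta_star_def)

text \<open>After division by \<open>x ^ N\<close>, a positive zero is a point where the sum of
  \<open>c_k * x ^ (-k)\<close> is 1. This form is monotone in \<open>x\<close> and later supplies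
  weights with sum 1.\<close>

lemma poly_zeckendorf_poly:
  assumes "admissible_list L" "x > 0"
  shows "poly (zeckendorf_poly L) x =
    x ^ length L * (1 - (\<Sum>k=1..length L. real (char_coeff L k) * (1/x) ^ k))"
proof -
  let ?N = "length L"
  have N: "?N \<ge> 2" using assms by (simp add: admissible_list_def)
  have split: "{1..?N} = insert ?N {1..?N - 1}" using N by auto
  have "x ^ ?N * (\<Sum>k=1..?N. real (char_coeff L k) * (1/x) ^ k) =
      (\<Sum>k=1..?N. real (char_coeff L k) * x ^ (?N - k))"
    using \<open>x > 0\<close> unfolding sum_distrib_left
    by (intro sum.cong) (auto simp: power_diff field_simps)
  also have "\<dots> = (\<Sum>k=1..?N - 1. real (char_coeff L k) * x ^ (?N - k)) + real (char_coeff L ?N)"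
    unfolding split using N by (subst sum.insert) auto
  also have "(\<Sum>k=1..?N - 1. real (char_coeff L k) * x ^ (?N - k)) =
      (\<Sum>k=1..?N - 1. real (L ! (k - 1)) * x ^ (?N - k))"
    by (intro sum.cong) (auto simp: char_coeff_def beta_star_def)
  also have "char_coeff L ?N = 1 + L ! (?N - 1)"
    using N by (auto simp: char_coeff_def beta_star_def)
  finally show ?thesis
    by (simp add: zeckendorf_poly_def Let_def poly_sum poly_monom algebra_simps)
qed

lemma char_sum_strict_decreasing:
  assumes "admissible_list L" "0 < x" "x < y"
  shows "(\<Sum>k=1..length L. real (char_coeff L k) * (1/y) ^ k) <
         (\<Sum>k=1..length L. real (char_coeff L k) * (1/x) ^ k)"
proof (rule sum_strict_mono_ex1)
  have "1/y < 1/x" using assms by (simp add: field_simps)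
  then show "\<forall>k\<in>{1..length L}. real (char_coeff L k) * (1/y) ^ k \<le> real (char_coeff L k) * (1/x) ^ k"
    using assms by (auto intro!: mult_left_mono power_mono)
  have "1 \<in> {1..length L}" "real (char_coeff L 1) * (1/y) ^ 1 < real (char_coeff L 1) * (1/x) ^ 1"
    using assms \<open>1/y < 1/x\<close> beta_star_1[of L]
    by (auto simp: char_coeff_def admissible_list_def simp del: One_nat_def intro!: divide_strict_left_mono)
  then show "\<exists>k\<in>{1..length L}. real (char_coeff L k) * (1/y) ^ k < real (char_coeff L k) * (1/x) ^ k"
    by blast
qed simp

text \<open>The sum is at least 2 at \<open>x = 1\<close>, since the first and the last coefficient
  are positive, and at most 1 further out. The intermediate value theorem gives existence and strict
  monotonicity uniqueness, so the \<open>THE\<close> in \<open>positive_zero\<close> is well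
  defined.\<close>

lemma positive_zero:
  assumes L: "admissible_list L"
  shows positive_zero_gt_1: "positive_zero L > 1"
    and char_sum_positive_zero:
      "(\<Sum>k=1..length L. real (char_coeff L k) * (1 / positive_zero L) ^ k) = 1"
proof -
  define S where "S x = (\<Sum>k=1..length L. real (char_coeff L k) * (1/x) ^ k)" for x :: real
  have zero_iff: "poly (zeckendorf_poly L) x = 0 \<longleftrightarrow> S x = 1" if "x > 0" for x
    using poly_zeckendorf_poly[OF L that] that by (auto simp: S_def)
  have N: "length L \<ge> 2" using L by (simp add: admissible_list_def)
  have ends: "{1, length L} \<subseteq> {1..length L}" using N by auto
  have "(\<Sum>k\<in>{1, length L}. real (char_coeff L k)) \<le> S 1"
    unfolding S_def using ends by (auto intro!: sum_mono2)
  then have S1: "S 1 \<ge> 2"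
    using N beta_star_1[OF L] by (auto simp: char_coeff_def)
  \<comment> \<open>Chosen so that \<open>(1/y) ^ k \<le> 1/y\<close> yields
    \<open>S y \<le> (y - 1) / y\<close>.\<close>
  define y where "y = 1 + (\<Sum>k=1..length L. real (char_coeff L k))"
  have y: "y \<ge> 1" by (simp add: y_def sum_nonneg)
  have "S y \<le> (\<Sum>k=1..length L. real (char_coeff L k) * (1/y))"
    unfolding S_def using y power_decreasing[of 1 _ "1/y"]
    by (intro sum_mono mult_left_mono) auto
  also have "\<dots> = (y - 1) / y"
    by (simp add: y_def sum_divide_distrib)
  also have "\<dots> \<le> 1" using y by simp
  finally have Sy: "S y \<le> 1" .
  have "continuous_on {1..y} S"
    unfolding S_def by (intro continuous_intros) auto
  then obtain x where x: "1 \<le> x" "S x = 1"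
    using IVT2'[of S y 1 1] S1 Sy y by auto
  have "x \<noteq> 1" using x S1 by auto
  have unique: "z = x" if "z > 0" "S z = 1" for z
    using char_sum_strict_decreasing[OF L, of x z] char_sum_strict_decreasing[OF L, of z x] that x
    by (fold S_def) (cases z x rule: linorder_cases; force)
  have "positive_zero L = x"
    unfolding positive_zero_def using x unique zero_iff by (intro the_equality) auto
  then show "positive_zero L > 1"
    "(\<Sum>k=1..length L. real (char_coeff L k) * (1 / positive_zero L) ^ k) = 1"
    using x \<open>x \<noteq> 1\<close> by (auto simp: S_def)
qed

text \<open>One period has value \<open>1 - ?x ^ N\<close>: the characteristic sum 1 minus the extra
  unit at \<open>N\<close>. The period after \<open>q\<close> others is scaled by
  \<open>?x ^ (q * N)\<close>, so the values telescope.\<close>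

lemma beta_star_sum_periods:
  assumes L: "admissible_list L"
  shows "(\<Sum>i=1..q * length L. real (beta_star L i) * (1 / positive_zero L) ^ i) =
         1 - (1 / positive_zero L) ^ (q * length L)"
proof (induction q)
  case (Suc q)
  let ?N = "length L" and ?x = "1 / positive_zero L"
  let ?f = "\<lambda>i. real (beta_star L i) * ?x ^ i"
  have "(\<Sum>i=1..Suc q * ?N. ?f i) = (\<Sum>i=1..q * ?N. ?f i) + (\<Sum>i=q * ?N + 1..q * ?N + ?N. ?f i)"
    by (subst sum.ub_add_nat[symmetric]) (auto simp: add.commute)
  also have "(\<Sum>i=q * ?N + 1..q * ?N + ?N. ?f i) = (\<Sum>i=1..?N. ?f (i + q * ?N))"
    using sum.shift_bounds_cl_nat_ivl[of ?f 1 "q * ?N" ?N] by (simp add: add.commute)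
  also have "\<dots> = ?x ^ (q * ?N) * (\<Sum>i=1..?N. ?f i)"
    unfolding sum_distrib_left
    by (intro sum.cong) (auto simp: beta_star_periodic power_add)
  also have "(\<Sum>i=1..?N. ?f i) = (\<Sum>i=1..?N. real (char_coeff L i) * ?x ^ i - (if i = ?N then ?x ^ ?N else 0))"
    by (intro sum.cong) (auto simp: char_coeff_def algebra_simps)
  also have "\<dots> = 1 - ?x ^ ?N"
    unfolding sum_subtractf char_sum_positive_zero[OF L] using L by (simp add: admissible_list_def)
  finally show ?case
    using Suc by (simp add: algebra_simps power_add)
qed simp

lemma beta_star_sum_less_1:
  assumes L: "admissible_list L"
  shows "(\<Sum>i=1..m. real (beta_star L i) * (1 / positive_zero L) ^ i) < 1"
proof -
  let ?x = "1 / positive_zero L"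
  have x: "?x > 0" using positive_zero_gt_1[OF L] by simp
  have "m \<le> m * length L" using L by (simp add: admissible_list_def)
  then have "(\<Sum>i=1..m. real (beta_star L i) * ?x ^ i) \<le> (\<Sum>i=1..m * length L. real (beta_star L i) * ?x ^ i)"
    using x by (intro sum_mono2) auto
  also have "\<dots> < 1"
    unfolding beta_star_sum_periods[OF L] using x by simp
  finally show ?thesis .
qed

section \<open>Growth of the fundamental sequence\<close>

lemma fundamental_seq_beta_star:
  assumes "n \<ge> 1"
  shows "fundamental_seq L n = 1 + (\<Sum>j=1..n - 1. beta_star L j * fundamental_seq L (n - j))"
proof -
  have "(\<Sum>k=1..n - 1. theta L n k * fundamental_seq L k) =
      (\<Sum>k=1..n - 1. beta_star L (n - k) * fundamental_seq L k)"
    by (intro sum.cong) (auto simp: theta_def rev_coeff_def)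
  also have "\<dots> = (\<Sum>j=1..n - 1. beta_star L j * fundamental_seq L (n - j))"
    by (rule sum.reindex_bij_witness[of _ "\<lambda>j. n - j" "\<lambda>j. n - j"]) auto
  finally show ?thesis
    using assms by (subst fundamental_seq.simps) auto
qed

lemma fundamental_seq_pos: "fundamental_seq L n > 0"
  by (subst fundamental_seq.simps) simp

text \<open>The sum is cut after one period. By periodicity the tail together with the summand 1 is
  the expansion of \<open>H (n - N)\<close>, which accounts for the extra unit in
  \<open>char_coeff\<close>.\<close>

lemma fundamental_seq_linear_recurrence:
  assumes L: "admissible_list L" and n: "n > length L"
  shows "fundamental_seq L n = (\<Sum>k=1..length L. char_coeff L k * fundamental_seq L (n - k))"
proof -
  let ?N = "length L" and ?H = "fundamental_seq L"
  let ?f = "\<lambda>j. beta_star L j * ?H (n - j)"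
  have "?H n = 1 + (\<Sum>j=1..?N + (n - ?N - 1). ?f j)"
    using fundamental_seq_beta_star[of n L] n by simp
  also have "\<dots> = 1 + (\<Sum>j=1..?N. ?f j) + (\<Sum>j=?N + 1..?N + (n - ?N - 1). ?f j)"
    by (subst sum.ub_add_nat) auto
  also have "(\<Sum>j=?N + 1..?N + (n - ?N - 1). ?f j) = (\<Sum>j=1..n - ?N - 1. ?f (j + ?N))"
    using sum.shift_bounds_cl_nat_ivl[of ?f 1 ?N "n - ?N - 1"] by (simp add: add.commute)
  also have "\<dots> = (\<Sum>j=1..n - ?N - 1. beta_star L j * ?H (n - ?N - j))"
    by (intro sum.cong) (use beta_star_periodic[of _ L 1] in \<open>auto simp: add.commute\<close>)
  also have "1 + (\<Sum>j=1..?N. ?f j) + \<dots> = (\<Sum>j=1..?N. ?f j) + ?H (n - ?N)"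
    using fundamental_seq_beta_star[of "n - ?N" L] n by simp
  also have "\<dots> = (\<Sum>j=1..?N. ?f j + (if j = ?N then ?H (n - ?N) else 0))"
    using L by (simp add: sum.distrib admissible_list_def)
  also have "\<dots> = (\<Sum>k=1..?N. char_coeff L k * ?H (n - k))"
    by (intro sum.cong) (auto simp: char_coeff_def)
  finally show ?thesis .
qed

theorem fundamental_seq_asymptotics:
  assumes L: "admissible_list L"
  obtains \<alpha> \<rho> C where "0 < \<alpha>" "0 < \<rho>" "\<rho> < 1"
    "\<And>n. \<bar>real (fundamental_seq L (Suc n)) / positive_zero L ^ n - \<alpha>\<bar> \<le> C * \<rho> ^ n"
proof -
  let ?N = "length L" and ?\<phi> = "positive_zero L"
  define p where "p k = real (char_coeff L k) * (1 / ?\<phi>) ^ k" for k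
  define u where "u n = real (fundamental_seq L (Suc n)) / ?\<phi> ^ n" for n
  have \<phi>: "?\<phi> > 1" by (rule positive_zero_gt_1[OF L])
  have N: "?N \<ge> 2" using L by (simp add: admissible_list_def)
  have p1: "p 1 > 0" using beta_star_1[OF L] \<phi> by (simp add: p_def char_coeff_def)
  have pN: "p ?N > 0" using \<phi> by (simp add: p_def char_coeff_def)
  have p: "p k \<ge> 0" for k using \<phi> by (simp add: p_def)
  have sum_p: "(\<Sum>k=1..?N. p k) = 1"
    unfolding p_def by (rule char_sum_positive_zero[OF L])
  \<comment> \<open>The weights at the distinct indices \<open>1\<close> and \<open>N\<close> are
    positive and sum to at most 1.\<close>
  have "(\<Sum>k\<in>{1, ?N}. p k) \<le> (\<Sum>k=1..?N. p k)"
    using N p by (intro sum_mono2) auto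
  then have "p 1 < 1"
    using N pN sum_p by simp
  interpret averaging_recurrence p ?N
    using N p p1 sum_p \<open>p 1 < 1\<close> by unfold_locales auto
  have "solution u"
    unfolding solution_def
  proof (intro allI impI)
    fix n assume n: "n \<ge> ?N"
    have "u n = (\<Sum>k=1..?N. real (char_coeff L k) * real (fundamental_seq L (Suc n - k)) / ?\<phi> ^ n)"
      unfolding u_def using n
      by (subst fundamental_seq_linear_recurrence[OF L]) (auto simp: sum_divide_distrib)
    also have "\<dots> = (\<Sum>k=1..?N. p k * u (n - k))"
      using n \<phi> by (intro sum.cong) (auto simp: p_def u_def Suc_diff_le power_diff field_simps)
    finally show "u n = (\<Sum>k=1..?N. p k * u (n - k))" .
  qed
  moreover have "Min (u ` {..<?N}) \<le> u i \<and> u i \<le> Max (u ` {..<?N})" if "i < ?N" for i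
    using that by auto
  ultimately obtain l \<rho> C where l: "Min (u ` {..<?N}) \<le> l" "0 < \<rho>" "\<rho> < 1"
    "\<And>n. \<bar>u n - l\<bar> \<le> C * \<rho> ^ n"
    by (rule solution_exponential_convergence) blast+
  \<comment> \<open>The limit is at least the minimum over the first window, whose values are
    positive.\<close>
  have "0 < Min (u ` {..<?N})"
    using N \<phi> fundamental_seq_pos[of L] by (subst Min_gr_iff) (auto simp: u_def lessThan_empty_iff)
  then have "0 < l" using l(1) by linarith
  then show thesis
    by (rule that[OF _ l(2,3) l(4)[unfolded u_def]])
qed

text \<open>The error is of order \<open>(\<phi> * \<rho>) ^ n\<close>, and
  \<open>\<phi> * \<rho>\<close> is \<open>\<phi>\<close> to the exponent
  \<open>1 + log \<phi> \<rho>\<close>. Only an inequality is asked of \<open>r\<close>, so that two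
  sequences can share one exponent.\<close>

lemma fundamental_seq_bigo:
  assumes \<phi>: "\<phi> > 1" and \<rho>: "0 < \<rho>" "\<rho> < 1" and r: "1 + log \<phi> \<rho> \<le> r"
    and bound: "\<And>n. \<bar>real (fundamental_seq L (Suc n)) / \<phi> ^ n - \<alpha>\<bar> \<le> C * \<rho> ^ n"
  shows "(\<lambda>n. real (fundamental_seq L n) - \<alpha> * \<phi> ^ (n - 1)) \<in> O(\<lambda>n. \<phi> powr (real n * r))"
proof (rule bigoI[where c = "C / (\<phi> * \<rho>)"])
  show "\<forall>\<^sub>F n in sequentially. norm (real (fundamental_seq L n) - \<alpha> * \<phi> ^ (n - 1))
      \<le> C / (\<phi> * \<rho>) * norm (\<phi> powr (real n * r))"
  proof (rule eventually_sequentiallyI[of 1])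
    fix n :: nat assume "1 \<le> n"
    then obtain m where m: "n = Suc m" by (cases n) auto
    have "C \<ge> 0" using bound[of 0] by auto
    have "\<bar>real (fundamental_seq L n) - \<alpha> * \<phi> ^ m\<bar> =
        \<phi> ^ m * \<bar>real (fundamental_seq L (Suc m)) / \<phi> ^ m - \<alpha>\<bar>"
      using \<phi> m by (simp add: abs_mult_pos' field_simps)
    also have "\<dots> \<le> \<phi> ^ m * (C * \<rho> ^ m)"
      using \<phi> by (intro mult_left_mono bound) auto
    also have "\<dots> = C / (\<phi> * \<rho>) * (\<phi> * \<rho>) ^ n"
      using \<phi> \<rho> by (simp add: m power_mult_distrib)
    also have "(\<phi> * \<rho>) ^ n = \<phi> powr (real n * (1 + log \<phi> \<rho>))"
    proof -
      have "\<phi> * \<rho> = \<phi> powr (1 + log \<phi> \<rho>)"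
        using \<phi> \<rho> by (simp add: powr_add)
      then show ?thesis
        using \<phi> by (simp add: powr_realpow[symmetric] powr_powr mult.commute)
    qed
    also have "C / (\<phi> * \<rho>) * \<dots> \<le> C / (\<phi> * \<rho>) * \<phi> powr (real n * r)"
      using \<phi> \<rho> r \<open>C \<ge> 0\<close> by (intro mult_left_mono powr_mono) auto
    finally show "norm (real (fundamental_seq L n) - \<alpha> * \<phi> ^ (n - 1))
        \<le> C / (\<phi> * \<rho>) * norm (\<phi> powr (real n * r))"
      by (simp add: m)
  qed
qed

lemma fundamental_seq_tendsto:
  assumes \<rho>: "0 < \<rho>" "\<rho> < (1::real)"
    and bound: "\<And>n. \<bar>real (fundamental_seq L (Suc n)) / \<phi> ^ n - \<alpha>\<bar> \<le> C * \<rho> ^ n"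
  shows "(\<lambda>n. real (fundamental_seq L (Suc n)) / \<phi> ^ n) \<longlonglongrightarrow> \<alpha>"
proof (rule LIM_zero_cancel, rule tendsto_rabs_zero_cancel, rule tendsto_sandwich)
  show "\<forall>\<^sub>F n in sequentially. 0 \<le> \<bar>real (fundamental_seq L (Suc n)) / \<phi> ^ n - \<alpha>\<bar>"
    by simp
  show "\<forall>\<^sub>F n in sequentially. \<bar>real (fundamental_seq L (Suc n)) / \<phi> ^ n - \<alpha>\<bar> \<le> C * \<rho> ^ n"
    using bound by simp
  show "(\<lambda>_. 0 :: real) \<longlonglongrightarrow> 0"
    by simp
  show "(\<lambda>n. C * \<rho> ^ n) \<longlonglongrightarrow> 0"
    using tendsto_mult_right_zero[OF LIMSEQ_power_zero[of \<rho>]] \<rho> by simp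
qed

section \<open>Comparison of the dominant zeros\<close>

lemma theta_eq: "1 \<le> k \<Longrightarrow> k < n \<Longrightarrow> theta L n k = beta_star L (n - k)"
  by (simp add: theta_def rev_coeff_def)

lemma theta_eq_0: "k < 1 \<or> n \<le> k \<Longrightarrow> theta L n k = 0"
  by (auto simp: theta_def rev_coeff_def)

text \<open>From the top downwards the digits of \<open>theta L n\<close> are those of
  \<open>beta_star L\<close>, so its upper part is a partial expansion in base \<open>x\<close>,
  scaled by \<open>x ^ n\<close>.\<close>

lemma theta_sum:
  assumes "x > (0::real)" "1 \<le> k" "k \<le> n"
  shows "(\<Sum>j=k..<n. real (theta L n j) * x ^ j) =
         x ^ n * (\<Sum>i=1..n - k. real (beta_star L i) * (1/x) ^ i)"
proof -
  have "(\<Sum>j=k..<n. real (theta L n j) * x ^ j) = (\<Sum>i=1..n - k. real (beta_star L i) * x ^ (n - i))"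
    using assms
    by (intro sum.reindex_bij_witness[of _ "\<lambda>i. n - i" "\<lambda>i. n - i"]) (auto simp: theta_eq)
  also have "\<dots> = (\<Sum>i=1..n - k. x ^ n * (real (beta_star L i) * (1/x) ^ i))"
    using assms by (intro sum.cong) (auto simp: power_diff field_simps)
  finally show ?thesis by (simp add: sum_distrib_left)
qed

lemma theta_sum_less:
  assumes L: "admissible_list L" and "1 \<le> k" "k \<le> n"
  shows "(\<Sum>j=k..<n. real (theta L n j) * positive_zero L ^ j) < positive_zero L ^ n"
  using assms positive_zero_gt_1[OF L] beta_star_sum_less_1[OF L, of "n - k"]
  by (subst theta_sum) auto

section \<open>Values of blocks in a real base\<close>

definition block_value :: "real \<Rightarrow> coeff_fun \<times> nat set \<Rightarrow> real" where
  "block_value x b = (\<Sum>j\<in>snd b. real (fst b j) * x ^ j)"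

lemma L_blocks_cases:
  assumes "b \<in> L_blocks L"
  obtains (maximal) n where "n \<ge> 2" "b = (theta L n, {1..<n})"
  | (proper) \<zeta> k n where "n \<ge> 2" "1 \<le> k" "k < n" "b = (\<zeta>, {k..<n})" "\<And>j. j > k \<Longrightarrow> \<zeta> j = theta L n j"
      "\<zeta> k < theta L n k" "\<And>j. j < k \<Longrightarrow> \<zeta> j = 0"
proof -
  have interval: "{k..n - 1} = {k..<n}" if "n \<ge> 2" for k n :: nat
    using that by auto
  from assms show thesis
    unfolding L_blocks_def maximal_blocks_def proper_blocks_def
  proof (elim UnE CollectE exE conjE)
    fix n assume "b = (theta L n, {1..n - 1})" "n \<ge> 2"
    then show thesis using interval by (intro that(1)) auto
  next
    fix \<zeta> k n assume "b = (\<zeta>, {k..n - 1})" "n \<ge> 2" "k \<in> {1..n - 1}"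
      "\<forall>j>k. \<zeta> j = theta L n j" "\<zeta> k < theta L n k" "\<forall>j<k. \<zeta> j = 0"
    then show thesis using interval by (intro that(2)[of n k \<zeta>]) auto
  qed
qed

lemma L_blocks_support:
  assumes "b \<in> L_blocks L" "fst b j \<noteq> 0"
  shows "j \<in> snd b"
  using assms(1)
proof (cases rule: L_blocks_cases)
  case (maximal n)
  then show ?thesis using assms(2) theta_eq_0[of j n L] by (force simp: not_less)
next
  case (proper \<zeta> k n)
  then show ?thesis
    using assms(2) theta_eq_0[of j n L] by (cases j k rule: linorder_cases) (force simp: not_less)+
qed

text \<open>The top digit is the nonzero first entry of \<open>L\<close>, unless the block is proper
  with a one-point interval, where it is the only digit. Thus a nonzero block cannot reach above the
  support of a sum that contains it.\<close>

lemma L_blocks_top_nonzero: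
  assumes L: "admissible_list L" and b: "b \<in> L_blocks L" "fst b \<noteq> (\<lambda>_. 0)"
  obtains k n where "1 \<le> k" "k < n" "snd b = {k..<n}" "fst b (n - 1) \<noteq> 0"
  using b(1)
proof (cases rule: L_blocks_cases)
  case (maximal n)
  then show ?thesis
    using beta_star_1[OF L] by (intro that[of 1 n]) (auto simp: theta_eq)
next
  case (proper \<zeta> k n)
  have "\<zeta> (n - 1) \<noteq> 0"
  proof (cases "k = n - 1")
    case True
    obtain j where j: "\<zeta> j \<noteq> 0" using b(2) proper(4) by (auto simp: fun_eq_iff)
    have "theta L n j' = 0" if "j' > k" for j'
      using that True by (intro theta_eq_0) auto
    with j proper have "j = k" by (metis linorder_neqE_nat)
    with j True show ?thesis by simp
  next
    case False
    then show ?thesis using proper beta_star_1[OF L] by (simp add: theta_eq)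
  qed
  then show ?thesis using proper by (intro that[of k n]) auto
qed

text \<open>The digit at \<open>k\<close> falls short by at least one, which costs
  \<open>x ^ k\<close>.\<close>

lemma proper_block_value:
  assumes "1 \<le> k" "k < n" "x > 0" "\<And>j. j > k \<Longrightarrow> \<zeta> j = theta L n j" "\<zeta> k < theta L n k"
  shows "block_value x (\<zeta>, {k..<n}) \<le> (\<Sum>j=k..<n. real (theta L n j) * x ^ j) - x ^ k"
proof -
  have "real (\<zeta> k) \<le> real (theta L n k) - 1" using assms(5) by linarith
  then have "real (\<zeta> k) * x ^ k \<le> (real (theta L n k) - 1) * x ^ k"
    using \<open>x > 0\<close> by (intro mult_right_mono) auto
  moreover have "(\<Sum>j=Suc k..<n. real (\<zeta> j) * x ^ j) = (\<Sum>j=Suc k..<n. real (theta L n j) * x ^ j)"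
    using assms(4) by (intro sum.cong) auto
  ultimately show ?thesis
    using \<open>k < n\<close> by (simp add: block_value_def sum.atLeast_Suc_lessThan algebra_simps)
qed

lemma sum_telescope_power:
  "k \<le> n \<Longrightarrow> (\<Sum>j=k..<n. (x - 1) * x ^ j) = x ^ n - (x ^ k :: real)"
  using sum_Suc_diff'[of k n "\<lambda>j. x ^ j"] by (simp add: algebra_simps)

text \<open>The excess at index \<open>1\<close> pays for a maximal block, the only kind of block whose value is
  not bounded by the telescoping sum of \<open>x ^ (j + 1) - x ^ j\<close> over its support interval.\<close>

lemma block_value_le:
  assumes L: "admissible_list L" and b: "b \<in> L_blocks L"
  defines "x \<equiv> positive_zero L"
  shows "block_value x b \<le> (\<Sum>j\<in>snd b. (x - 1) * x ^ j + (if j = 1 then x else 0))"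
proof -
  have x: "x > 1" unfolding x_def by (rule positive_zero_gt_1[OF L])
  show ?thesis
    using b
  proof (cases rule: L_blocks_cases)
    case (maximal n)
    then show ?thesis
      using theta_sum_less[OF L, of 1 n] sum_telescope_power[of 1 n x]
      by (simp add: block_value_def sum.distrib x_def)
  next
    case (proper \<zeta> k n)
    have "block_value x b \<le> (\<Sum>j=k..<n. real (theta L n j) * x ^ j) - x ^ k"
      unfolding proper(4) using x proper by (intro proper_block_value) auto
    also have "\<dots> \<le> (\<Sum>j=k..<n. (x - 1) * x ^ j)"
      using theta_sum_less[OF L, of k n] proper sum_telescope_power[of k n x] by (simp add: x_def)
    also have "\<dots> \<le> (\<Sum>j\<in>snd b. (x - 1) * x ^ j + (if j = 1 then x else 0))"
      unfolding proper(4) snd_conv using x by (intro sum_mono) auto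
    finally show ?thesis .
  qed
qed

text \<open>Disjointness lets the bounds of \<open>block_value_le\<close> add up over
  \<open>[1, k - 1]\<close>: the telescoping part is \<open>x ^ k - x\<close>, and index
  \<open>1\<close> adds at most one excess \<open>x\<close>.\<close>

lemma sum_block_value_le:
  assumes L: "admissible_list L" and "finite B" "B \<subseteq> L_blocks L"
    and disj: "pairwise (\<lambda>b c. disjnt (snd b) (snd c)) B"
    and "1 \<le> k" and bound: "\<And>b. b \<in> B \<Longrightarrow> snd b \<subseteq> {1..<k}"
  shows "(\<Sum>b\<in>B. block_value (positive_zero L) b) \<le> positive_zero L ^ k"
proof -
  let ?x = "positive_zero L"
  let ?g = "\<lambda>j. (?x - 1) * ?x ^ j + (if j = 1 then ?x else 0)"
  have x: "?x > 1" by (rule positive_zero_gt_1[OF L])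
  have "(\<Sum>b\<in>B. block_value ?x b) \<le> (\<Sum>b\<in>B. sum ?g (snd b))"
    using assms by (intro sum_mono block_value_le) auto
  also have "\<dots> = sum ?g (\<Union>b\<in>B. snd b)"
    using \<open>finite B\<close> bound disj
    by (intro sum.UNION_disjoint[symmetric])
      (auto simp: pairwise_def disjnt_def intro: finite_subset)
  also have "\<dots> \<le> sum ?g {1..<k}"
    using bound x by (intro sum_mono2) auto
  also have "\<dots> \<le> ?x ^ k"
    using sum_telescope_power[of 1 k ?x] x \<open>1 \<le> k\<close> by (auto simp: sum.distrib)
  finally show ?thesis .
qed

section \<open>From the inclusion of collections to the inequality of the zeros\<close>

lemma theta_in_zeckendorf_collection:
  assumes "n \<ge> 2"
  shows "theta L n \<in> zeckendorf_collection L"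
  unfolding zeckendorf_collection_def
  using assms
  by (intro CollectI exI[of _ "{(theta L n, {1..n - 1})}"])
    (auto simp: L_blocks_def maximal_blocks_def)

text \<open>Used in contrapositive form: different collections force the digit sequences to differ
  somewhere.\<close>

lemma zeckendorf_collection_cong:
  assumes "beta_star L = beta_star L'"
  shows "zeckendorf_collection L = zeckendorf_collection L'"
proof -
  have "theta L = theta L'" by (simp add: theta_def assms fun_eq_iff)
  then show ?thesis
    by (simp add: zeckendorf_collection_def L_blocks_def maximal_blocks_def proper_blocks_def)
qed

text \<open>The block with a nonzero digit at \<open>n - 1\<close> has an interval ending there. All
  other nonzero blocks are disjoint from it and do not reach beyond it, so they lie below
  \<open>k\<close> and leave its digits untouched.\<close>

lemma zeckendorf_collection_top_block:
  assumes L: "admissible_list L" and \<mu>: "\<mu> \<in> zeckendorf_collection L"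
    and n: "n \<ge> 2" "\<And>j. j \<ge> n \<Longrightarrow> \<mu> j = 0" "\<mu> (n - 1) \<noteq> 0"
  obtains B k \<zeta> where "finite B" "B \<subseteq> L_blocks L" "pairwise (\<lambda>b c. disjnt (snd b) (snd c)) B"
    "1 \<le> k" "k < n" "(\<zeta>, {k..<n}) \<in> L_blocks L" "\<And>j. j \<in> {k..<n} \<Longrightarrow> \<zeta> j = \<mu> j"
    "\<And>b. b \<in> B \<Longrightarrow> snd b \<subseteq> {1..<k}"
    "(\<Sum>j=1..<n. real (\<mu> j) * x ^ j) = block_value x (\<zeta>, {k..<n}) + (\<Sum>b\<in>B. block_value x b)"
proof -
  obtain B0 where B0: "finite B0" "B0 \<subseteq> L_blocks L" "pairwise (\<lambda>b c. disjnt (snd b) (snd c)) B0"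
    and \<mu>_B0: "\<mu> = (\<lambda>j. \<Sum>b\<in>B0. fst b j)"
    using \<mu> unfolding zeckendorf_collection_def by blast
  \<comment> \<open>Zero blocks may carry intervals that reach beyond \<open>n\<close>; dropping
    them keeps the sum.\<close>
  define B where "B = {b \<in> B0. fst b \<noteq> (\<lambda>_. 0)}"
  have B: "finite B" "B \<subseteq> L_blocks L" "pairwise (\<lambda>b c. disjnt (snd b) (snd c)) B"
    using B0 by (auto simp: B_def intro: pairwise_subset)
  have \<mu>_B: "\<mu> j = (\<Sum>b\<in>B. fst b j)" for j
    unfolding \<mu>_B0 B_def using B0(1) by (intro sum.mono_neutral_right) auto
  have top: "\<exists>k m. 1 \<le> k \<and> k < m \<and> m \<le> n \<and> snd b = {k..<m}" if b: "b \<in> B" for b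
  proof -
    obtain k m where km: "1 \<le> k" "k < m" "snd b = {k..<m}" "fst b (m - 1) \<noteq> 0"
      using b B(2) by (auto simp: B_def intro: L_blocks_top_nonzero[OF L, of b])
    \<comment> \<open>Coefficients are natural numbers, so nothing cancels.\<close>
    have "\<mu> (m - 1) \<noteq> 0"
      unfolding \<mu>_B using b km B(1) by auto
    then have "m \<le> n" using n(2)[of "m - 1"] by linarith
    with km show ?thesis by blast
  qed
  obtain b0 where b0: "b0 \<in> B" "fst b0 (n - 1) \<noteq> 0"
    using n(3) unfolding \<mu>_B by (meson sum.neutral)
  obtain k where k: "1 \<le> k" "k < n" "snd b0 = {k..<n}"
  proof -
    obtain k m where "1 \<le> k" "k < m" "m \<le> n" "snd b0 = {k..<m}" using top[OF b0(1)] by blast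
    moreover have "n - 1 \<in> snd b0" using b0 B by (auto intro: L_blocks_support)
    ultimately have "m = n" using n(1) by auto
    with \<open>snd b0 = {k..<m}\<close> \<open>1 \<le> k\<close> \<open>k < m\<close> show ?thesis by (intro that) auto
  qed
  have disj: "disjnt (snd b) (snd b0)" if "b \<in> B - {b0}" for b
    using that b0 B(3) by (auto simp: pairwise_def)
  show thesis
  proof (rule that[of "B - {b0}" k "fst b0"])
    show "finite (B - {b0})" "B - {b0} \<subseteq> L_blocks L"
      "pairwise (\<lambda>b c. disjnt (snd b) (snd c)) (B - {b0})"
      using B by (auto intro: pairwise_subset)
    show "1 \<le> k" "k < n" by (fact k)+
    have b0_eq: "(fst b0, {k..<n}) = b0" using k(3) by (metis prod.collapse)
    then show "(fst b0, {k..<n}) \<in> L_blocks L"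
      using b0 B by auto
    show "fst b0 j = \<mu> j" if "j \<in> {k..<n}" for j
    proof -
      have "fst b j = 0" if "b \<in> B - {b0}" for b
        using disj[OF that] that \<open>j \<in> {k..<n}\<close> k(3) B(2) L_blocks_support[of b L j]
        unfolding disjnt_def by blast
      then show ?thesis
        unfolding \<mu>_B using b0 B(1) by (subst sum.remove[of B b0]) auto
    qed
    show "snd b \<subseteq> {1..<k}" if b: "b \<in> B - {b0}" for b
    proof -
      obtain k' m where km: "1 \<le> k'" "k' < m" "m \<le> n" "snd b = {k'..<m}" using top[of b] b by auto
      have "m - 1 \<in> snd b" using km by auto
      then have "m - 1 \<notin> {k..<n}" using disj[OF b] k(3) by (auto simp: disjnt_def)
      then have "m \<le> k" using km by auto
      then show ?thesis using km by auto
    qed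
    have "(\<Sum>j=1..<n. real (\<mu> j) * x ^ j) = (\<Sum>j=1..<n. \<Sum>b\<in>B. real (fst b j) * x ^ j)"
      by (simp add: \<mu>_B sum_distrib_right)
    also have "\<dots> = (\<Sum>b\<in>B. \<Sum>j=1..<n. real (fst b j) * x ^ j)"
      by (rule sum.swap)
    also have "\<dots> = (\<Sum>b\<in>B. block_value x b)"
    proof (rule sum.cong[OF refl])
      fix b assume b: "b \<in> B"
      have "snd b \<subseteq> {1..<n}" using top[OF b] by auto
      moreover have "fst b j = 0" if "j \<notin> snd b" for j
        using that b B(2) L_blocks_support[of b L j] by blast
      ultimately show "(\<Sum>j=1..<n. real (fst b j) * x ^ j) = block_value x b"
        unfolding block_value_def by (intro sum.mono_neutral_right) auto
    qed
    also have "\<dots> = block_value x b0 + (\<Sum>b\<in>B - {b0}. block_value x b)"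
      using B(1) b0(1) by (rule sum.remove)
    finally show "(\<Sum>j=1..<n. real (\<mu> j) * x ^ j) =
        block_value x (fst b0, {k..<n}) + (\<Sum>b\<in>B - {b0}. block_value x b)"
      unfolding b0_eq .
  qed
qed

text \<open>The maximal block of \<open>L\<close> lies in the larger collection, and its top block
  there is a proper block of \<open>L'\<close> of length \<open>m\<close>. The resulting bound does
  not depend on \<open>n\<close>.\<close>

lemma beta_star_sum_le:
  assumes L: "admissible_list L" and L': "admissible_list L'"
    and sub: "zeckendorf_collection L \<subseteq> zeckendorf_collection L'"
    and m: "1 \<le> m" "\<And>i. 1 \<le> i \<Longrightarrow> i < m \<Longrightarrow> beta_star L i = beta_star L' i" "beta_star L m \<noteq> beta_star L' m"
    and "m < n"
  defines "x \<equiv> positive_zero L'"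
  shows "(\<Sum>i=1..n - 1. real (beta_star L i) * (1/x) ^ i) \<le> (\<Sum>i=1..m. real (beta_star L' i) * (1/x) ^ i)"
proof -
  have x: "x > 1" unfolding x_def by (rule positive_zero_gt_1[OF L'])
  have n: "n \<ge> 2" using m(1) \<open>m < n\<close> by simp
  have \<theta>: "theta L n \<in> zeckendorf_collection L'"
    using sub theta_in_zeckendorf_collection[OF n] by blast
  have zero: "theta L n j = 0" if "n \<le> j" for j
    using that by (simp add: theta_eq_0)
  have nonzero: "theta L n (n - 1) \<noteq> 0"
    using n beta_star_1[OF L] by (simp add: theta_eq)
  obtain B k \<zeta> where B: "finite B" "B \<subseteq> L_blocks L'" "pairwise (\<lambda>b c. disjnt (snd b) (snd c)) B"
    and k: "1 \<le> k" "k < n" and \<zeta>: "(\<zeta>, {k..<n}) \<in> L_blocks L'" "\<And>j. j \<in> {k..<n} \<Longrightarrow> \<zeta> j = theta L n j"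
    and below: "\<And>b. b \<in> B \<Longrightarrow> snd b \<subseteq> {1..<k}"
    and val: "(\<Sum>j=1..<n. real (theta L n j) * x ^ j) = block_value x (\<zeta>, {k..<n}) + (\<Sum>b\<in>B. block_value x b)"
    using zeckendorf_collection_top_block[OF L' \<theta> n zero nonzero, of x] by blast
  have interval: "n' = n \<and> k' = k" if "{k..<n} = {k'..<n'}" for k' n'
    using that k ivl_subset[of k n k' n'] ivl_subset[of k' n' k n] by auto
  \<comment> \<open>The digit of \<open>theta L n\<close> at \<open>n - i\<close> is
    \<open>beta_star L i\<close>. A maximal block would force agreement with \<open>L'\<close> at
    \<open>m\<close>; a proper one has its first deviation at \<open>n - k\<close>, which must then
    be \<open>m\<close>.\<close>
  have "k = n - m \<and> (\<forall>j>k. \<zeta> j = theta L' n j) \<and> \<zeta> k < theta L' n k"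
    using \<zeta>(1)
  proof (cases rule: L_blocks_cases)
    case (maximal n')
    then have "n' = n" "k = 1" using interval[of 1 n'] by auto
    then have "beta_star L m = beta_star L' m"
      using \<zeta>(2)[of "n - m"] maximal \<open>m < n\<close> m(1) by (simp add: theta_eq)
    with m(3) show ?thesis by simp
  next
    case (proper \<zeta>' k' n')
    then have eqs: "n' = n" "k' = k" "\<zeta>' = \<zeta>" using interval[of k' n'] by auto
    have same: "beta_star L i = beta_star L' i" if "1 \<le> i" "i < n - k" for i
      using proper(5)[of "n - i"] \<zeta>(2)[of "n - i"] that k eqs by (simp add: theta_eq)
    have "beta_star L (n - k) < beta_star L' (n - k)"
      using proper(6) \<zeta>(2)[of k] k eqs by (simp add: theta_eq)
    then have "\<not> n - k < m" "\<not> m < n - k"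
      using m(2)[of "n - k"] m(1,3) same[of m] k by force+
    then have "m = n - k" by simp
    then show ?thesis using proper eqs k by auto
  qed
  then have k_eq: "k = n - m" and agree: "\<And>j. j > k \<Longrightarrow> \<zeta> j = theta L' n j" "\<zeta> k < theta L' n k"
    by auto
  have "x ^ n * (\<Sum>i=1..n - 1. real (beta_star L i) * (1/x) ^ i) = (\<Sum>j=1..<n. real (theta L n j) * x ^ j)"
    using x n by (subst theta_sum) auto
  \<comment> \<open>The loss \<open>x ^ k\<close> of the proper block covers all that the blocks
    below \<open>k\<close> can add.\<close>
  also have "\<dots> \<le> ((\<Sum>j=k..<n. real (theta L' n j) * x ^ j) - x ^ k) + x ^ k"
    unfolding val
  proof (rule add_mono)
    show "block_value x (\<zeta>, {k..<n}) \<le> (\<Sum>j=k..<n. real (theta L' n j) * x ^ j) - x ^ k"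
      using k x agree by (intro proper_block_value) auto
    show "(\<Sum>b\<in>B. block_value x b) \<le> x ^ k"
      unfolding x_def by (rule sum_block_value_le[OF L' B k(1) below])
  qed
  also have "\<dots> = x ^ n * (\<Sum>i=1..m. real (beta_star L' i) * (1/x) ^ i)"
    using x k k_eq \<open>m < n\<close> by (simp add: theta_sum)
  finally show ?thesis using x by simp
qed

text \<open>If \<open>?x' \<le> ?x\<close>, the expansion of \<open>beta_star L\<close> in base
  \<open>?x\<close> is dominated by that in base \<open>?x'\<close>, whose partial sums stay below a
  constant \<open>s < 1\<close>. But in base \<open>?x\<close> the sums over whole periods tend to
  1.\<close>

theorem positive_zero_strict_mono:
  assumes L: "admissible_list L" and L': "admissible_list L'"
    and sub: "zeckendorf_collection L \<subset> zeckendorf_collection L'"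
  shows "positive_zero L < positive_zero L'"
proof (rule ccontr)
  let ?x = "positive_zero L" and ?x' = "positive_zero L'"
  assume "\<not> ?x < ?x'"
  then have le: "?x' \<le> ?x" by simp
  have x: "?x > 1" "?x' > 1" using L L' by (auto intro: positive_zero_gt_1)
  have "beta_star L \<noteq> beta_star L'"
    using zeckendorf_collection_cong sub by blast
  then have ex: "\<exists>i. beta_star L i \<noteq> beta_star L' i" by auto
  define m where "m = (LEAST i. beta_star L i \<noteq> beta_star L' i)"
  have m: "beta_star L m \<noteq> beta_star L' m" "\<And>i. i < m \<Longrightarrow> beta_star L i = beta_star L' i"
    unfolding m_def using LeastI_ex[OF ex] not_less_Least by blast+
  \<comment> \<open>Both sequences have the default value \<open>0\<close> at index
    \<open>0\<close>.\<close>
  then have "m \<noteq> 0" by (metis beta_star_def)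
  then have "1 \<le> m" by simp
  define s where "s = (\<Sum>i=1..m. real (beta_star L' i) * (1/?x') ^ i)"
  have "s < 1" unfolding s_def by (rule beta_star_sum_less_1[OF L'])
  have N: "length L \<ge> 2" using L by (simp add: admissible_list_def)
  have partial: "1 - (1/?x) ^ (q * length L) \<le> s" if "q \<ge> m" for q
  proof -
    have "m \<le> q * length L" using that N by (metis le_trans mult_le_mono2 mult.right_neutral one_le_numeral)
    have "1 - (1/?x) ^ (q * length L) = (\<Sum>i=1..q * length L. real (beta_star L i) * (1/?x) ^ i)"
      by (rule beta_star_sum_periods[OF L, symmetric])
    also have "\<dots> \<le> (\<Sum>i=1..q * length L. real (beta_star L i) * (1/?x') ^ i)"
      using le x by (intro sum_mono mult_left_mono power_mono) (auto simp: field_simps)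
    also have "\<dots> \<le> s"
      using beta_star_sum_le[OF L L' _ \<open>1 \<le> m\<close> _ m(1), of "q * length L + 1"] sub m(2) \<open>m \<le> q * length L\<close>
      by (auto simp: s_def)
    finally show ?thesis .
  qed
  have "(\<lambda>q. 1 - (1/?x) ^ (q * length L)) \<longlonglongrightarrow> 1 - 0"
  proof (intro tendsto_diff tendsto_const)
    have "(1/?x) ^ length L < 1"
      using x N by (intro power_less_one_iff[THEN iffD2]) auto
    then have "(\<lambda>q. ((1/?x) ^ length L) ^ q) \<longlonglongrightarrow> 0"
      using x by (intro LIMSEQ_power_zero) auto
    then show "(\<lambda>q. (1/?x) ^ (q * length L)) \<longlonglongrightarrow> 0"
      by (simp only: power_mult[symmetric] mult.commute)
  qed
  then have "1 - 0 \<le> s"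
    using partial by (intro LIMSEQ_le_const2) auto
  with \<open>s < 1\<close> show False by simp
qed

section \<open>Assembly of the asymptotics and the limit of the ratio\<close>

theorem theorem3p3:
  fixes L L' :: "nat list"
    and H H' :: "nat \<Rightarrow> nat"
    and \<phi> \<phi>' \<gamma> :: real
  assumes "admissible_list L" and "admissible_list L'"
    and "zeckendorf_collection L \<subset> zeckendorf_collection L'"
    and "H = fundamental_seq L" and "H' = fundamental_seq L'"
    and "\<phi> = positive_zero L" and "\<phi>' = positive_zero L'"
    and "\<gamma> = log \<phi>' \<phi>"
  shows "(\<exists>\<alpha> \<alpha>' r :: real. \<alpha> > 0 \<and> \<alpha>' > 0 \<and> 0 < r \<and> r < 1 \<and>
            (\<lambda>n. real (H n) - \<alpha> * \<phi> ^ (n - 1)) \<in> O(\<lambda>n. \<phi> powr (real n * r)) \<and>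
            (\<lambda>n. real (H' n) - \<alpha>' * \<phi>' ^ (n - 1)) \<in> O(\<lambda>n. \<phi>' powr (real n * r)) \<and>
            (\<lambda>n. real (H n) / real (H' n) powr \<gamma>) \<longlonglongrightarrow> \<alpha> / \<alpha>' powr \<gamma> \<and>
            \<alpha> / \<alpha>' powr \<gamma> > 0)
         \<and> 1 < \<phi> \<and> \<phi> < \<phi>'"
proof -
  have \<phi>: "1 < \<phi>" "\<phi> < \<phi>'"
    using assms positive_zero_gt_1 positive_zero_strict_mono by auto
  obtain \<alpha> \<rho> C where \<alpha>: "0 < \<alpha>" "0 < \<rho>" "\<rho> < 1"
    "\<And>n. \<bar>real (H (Suc n)) / \<phi> ^ n - \<alpha>\<bar> \<le> C * \<rho> ^ n"
    by (rule fundamental_seq_asymptotics[OF assms(1), folded assms(4,6)]) blast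
  obtain \<alpha>' \<rho>' C' where \<alpha>': "0 < \<alpha>'" "0 < \<rho>'" "\<rho>' < 1"
    "\<And>n. \<bar>real (H' (Suc n)) / \<phi>' ^ n - \<alpha>'\<bar> \<le> C' * \<rho>' ^ n"
    by (rule fundamental_seq_asymptotics[OF assms(2), folded assms(5,7)]) blast
  \<comment> \<open>Both logarithms are negative, so \<open>r < 1\<close>; the entry
    \<open>1/2\<close> keeps \<open>r\<close> positive.\<close>
  define r where "r = max (1/2) (max (1 + log \<phi> \<rho>) (1 + log \<phi>' \<rho>'))"
  have "0 < r" "r < 1"
    using \<phi> \<alpha> \<alpha>' by (auto simp: r_def)
  have O: "(\<lambda>n. real (H n) - \<alpha> * \<phi> ^ (n - 1)) \<in> O(\<lambda>n. \<phi> powr (real n * r))"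
    unfolding assms(4)
    by (rule fundamental_seq_bigo[OF \<phi>(1) \<alpha>(2,3) _ \<alpha>(4)[unfolded assms(4)]]) (simp add: r_def)
  have O': "(\<lambda>n. real (H' n) - \<alpha>' * \<phi>' ^ (n - 1)) \<in> O(\<lambda>n. \<phi>' powr (real n * r))"
    unfolding assms(5)
    by (rule fundamental_seq_bigo[OF _ \<alpha>'(2,3) _ \<alpha>'(4)[unfolded assms(5)]])
      (use \<phi> in \<open>auto simp: r_def\<close>)
  have lim: "(\<lambda>n. real (H (Suc n)) / \<phi> ^ n) \<longlonglongrightarrow> \<alpha>"
    using fundamental_seq_tendsto[OF \<alpha>(2,3)] \<alpha>(4) unfolding assms(4) by blast
  have lim': "(\<lambda>n. real (H' (Suc n)) / \<phi>' ^ n) \<longlonglongrightarrow> \<alpha>'"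
    using fundamental_seq_tendsto[OF \<alpha>'(2,3)] \<alpha>'(4) unfolding assms(5) by blast
  have "(\<lambda>n. (real (H (Suc n)) / \<phi> ^ n) / (real (H' (Suc n)) / \<phi>' ^ n) powr \<gamma>) \<longlonglongrightarrow> \<alpha> / \<alpha>' powr \<gamma>"
    using \<alpha>' by (intro tendsto_intros lim lim') auto
  moreover have "(real (H (Suc n)) / \<phi> ^ n) / (real (H' (Suc n)) / \<phi>' ^ n) powr \<gamma> =
      real (H (Suc n)) / real (H' (Suc n)) powr \<gamma>" for n
  proof -
    \<comment> \<open>The exponent \<open>\<gamma>\<close> is the one with
      \<open>\<phi>' powr \<gamma> = \<phi>\<close>, so the normalising powers cancel
      exactly.\<close>
    have "(\<phi>' ^ n) powr \<gamma> = (\<phi>' powr \<gamma>) ^ n"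
      using \<phi> by (simp add: powr_realpow[symmetric] powr_powr mult.commute)
    also have "\<phi>' powr \<gamma> = \<phi>"
      using \<phi> by (simp add: assms(8))
    finally show ?thesis
      using \<phi> by (simp add: powr_divide)
  qed
  ultimately have "(\<lambda>n. real (H (Suc n)) / real (H' (Suc n)) powr \<gamma>) \<longlonglongrightarrow> \<alpha> / \<alpha>' powr \<gamma>"
    by (simp only:)
  then have "(\<lambda>n. real (H n) / real (H' n) powr \<gamma>) \<longlonglongrightarrow> \<alpha> / \<alpha>' powr \<gamma>"
    by (rule LIMSEQ_imp_Suc)
  then show ?thesis
    using \<phi> \<alpha>(1) \<alpha>'(1) O O' \<open>0 < r\<close> \<open>r < 1\<close> by (intro conjI exI[of _ \<alpha>] exI[of _ \<alpha>'] exI[of _ r]) auto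
qed

end
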